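(* If $T$ is a densely defined unbounded (linear) operator on a complex Hilbert space $\mathcal{H}$, then its essential numerical range $W_e(T)$ is either empty or unbounded.
   Context: For an operator $T$ with domain $\mathcal{D}(T)\subseteq\mathcal{H}$, the essential numerical range is $$W_e(T)=\{\lambda\in\mathbb{C} : \exists\, x_n\in\mathcal{D}(T)\text{ with }\|x_n\|=1,\ x_n\to0\text{ weakly},\ \langle Tx_n,x_n\rangle\to\lambda\}.$$ *)

theory Defs
  imports "HOL-Analysis.Analysis"
begin

text \<open>
  Real scaling, norm, metric and topology are those of the library classes; the axioms below tie
  complex scaling and the complex inner product to them. The inner product is linear in its first
  argument.
\<close>

class complex_vector = real_vector +
  fixes scaleC :: "complex \<Rightarrow> 'a \<Rightarrow> 'a"  (infixr "*\<^sub>C" 75)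
  assumes scaleC_add_right: "c *\<^sub>C (x + y) = c *\<^sub>C x + c *\<^sub>C y"
    and scaleC_add_left: "(c + d) *\<^sub>C x = c *\<^sub>C x + d *\<^sub>C x"
    and scaleC_scaleC: "c *\<^sub>C d *\<^sub>C x = (c * d) *\<^sub>C x"
    and scaleC_one: "1 *\<^sub>C x = x"
    and scaleR_scaleC: "r *\<^sub>R x = complex_of_real r *\<^sub>C x"

global_interpretation cvec: vector_space "scaleC :: complex \<Rightarrow> 'a \<Rightarrow> 'a::complex_vector"
  by standard (rule scaleC_add_right scaleC_add_left scaleC_scaleC scaleC_one)+

class complex_inner = complex_vector + real_normed_vector +
  fixes cinner :: "'a \<Rightarrow> 'a \<Rightarrow> complex"
  assumes cinner_commute: "cinner x y = cnj (cinner y x)"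
    and cinner_add_left: "cinner (x + y) z = cinner x z + cinner y z"
    and cinner_scaleC_left: "cinner (c *\<^sub>C x) y = c * cinner x y"
    and cinner_self_norm: "cinner x x = complex_of_real ((norm x)\<^sup>2)"

class complex_hilbert = complex_inner + complete_space

definition weakly_tendsto :: "(nat \<Rightarrow> 'a::complex_inner) \<Rightarrow> 'a \<Rightarrow> bool" where
  "weakly_tendsto x l \<longleftrightarrow> (\<forall>y. (\<lambda>n. cinner (x n) y) \<longlonglongrightarrow> cinner l y)"

text \<open>
  An operator is a pair of a domain \<open>D\<close> and a function \<open>T\<close> of which only the values on \<open>D\<close> matter.
\<close>

definition linear_operator :: "'a::complex_vector set \<Rightarrow> ('a \<Rightarrow> 'a) \<Rightarrow> bool" where
  "linear_operator D T \<longleftrightarrow> cvec.subspace D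
     \<and> (\<forall>x\<in>D. \<forall>y\<in>D. T (x + y) = T x + T y)
     \<and> (\<forall>c. \<forall>x\<in>D. T (c *\<^sub>C x) = c *\<^sub>C T x)"

definition densely_defined :: "'a::topological_space set \<Rightarrow> bool" where
  "densely_defined D \<longleftrightarrow> closure D = UNIV"

definition bounded_operator :: "'a::real_normed_vector set \<Rightarrow> ('a \<Rightarrow> 'a) \<Rightarrow> bool" where
  "bounded_operator D T \<longleftrightarrow> (\<exists>C. \<forall>x\<in>D. norm (T x) \<le> C * norm x)"

definition essential_numerical_range ::
    "'a::complex_inner set \<Rightarrow> ('a \<Rightarrow> 'a) \<Rightarrow> complex set" where
  "essential_numerical_range D T =
     {z. \<exists>x :: nat \<Rightarrow> 'a. (\<forall>n. x n \<in> D) \<and> (\<forall>n. norm (x n) = 1) \<and> weakly_tendsto x 0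
        \<and> (\<lambda>n. cinner (T (x n)) (x n)) \<longlonglongrightarrow> z}"

end

theory Submission
  imports Defs
begin

text \<open>
  An unbounded operator on a dense domain has an unbounded quadratic form, by polarization. Let
  \<open>x\<^sub>n\<close> realize a point \<open>z\<close> of the essential numerical range, let \<open>M > 0\<close>, and take a unit vector
  \<open>y\<close> in the domain with \<open>\<bar>\<langle>Ty, y\<rangle>\<bar>\<close> huge. In
  \<open>\<langle>T(x\<^sub>n + sy), x\<^sub>n + sy\<rangle> = \<langle>Tx\<^sub>n, x\<^sub>n\<rangle> + s\<langle>Ty, x\<^sub>n\<rangle> + (s\<^sup>*\<langle>Tx\<^sub>n, y\<rangle> + \<bar>s\<bar>\<^sup>2\<langle>Ty, y\<rangle>)\<close>
  the first term is close to \<open>z\<close> and the second is small for large \<open>n\<close>. Choosing the phase of \<open>s\<close> so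
  that the two terms in the bracket point in the same direction, and then \<open>\<bar>s\<bar>\<close> so that their sum has
  modulus exactly \<open>M\<close>, forces \<open>\<bar>s\<bar> \<le> sqrt (M / \<bar>\<langle>Ty, y\<rangle>\<bar>)\<close>, no matter how large
  \<open>\<langle>Tx\<^sub>n, y\<rangle>\<close> is. So \<open>x\<^sub>n + sy\<close> is still asymptotically normalized and weakly null, and a
  subsequence gives a point of the essential numerical range at distance \<open>M\<close> from \<open>z\<close>.
\<close>

section \<open>Inner product geometry: norm of complex multiples, Cauchy-Schwarz, continuity\<close>

context complex_inner
begin

lemma cinner_add_right: "cinner x (y + z) = cinner x y + cinner x z"
  by (metis cinner_add_left cinner_commute complex_cnj_add)

lemma cinner_scaleC_right: "cinner x (c *\<^sub>C y) = cnj c * cinner x y"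
  by (metis cinner_commute cinner_scaleC_left complex_cnj_mult)

end

lemma cinner_zero_left [simp]: "cinner 0 (y::'a::complex_inner) = 0"
  using cinner_add_left[of 0 0 y] by simp

lemma norm_scaleC: "norm (c *\<^sub>C x) = cmod c * norm (x::'a::complex_inner)"
proof -
  have "complex_of_real ((norm (c *\<^sub>C x))\<^sup>2) = c * cnj c * complex_of_real ((norm x)\<^sup>2)"
    by (simp flip: cinner_self_norm add: cinner_scaleC_left cinner_scaleC_right del: of_real_power)
  also have "\<dots> = complex_of_real ((cmod c * norm x)\<^sup>2)"
    by (simp flip: complex_norm_square add: power_mult_distrib)
  finally have "(norm (c *\<^sub>C x))\<^sup>2 = (cmod c * norm x)\<^sup>2"
    using of_real_eq_iff by blast
  then show ?thesis
    by simp
qed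

lemma cinner_Cauchy_Schwarz: "cmod (cinner x y) \<le> norm x * norm (y::'a::complex_inner)"
proof (cases "y = 0")
  case True
  then show ?thesis
    using cinner_commute[of x 0] by simp
next
  case False
  define r where "r = (norm y)\<^sup>2"
  define b where "b = cinner x y"
  \<comment> \<open>\<open>v\<close> is \<open>r\<close> times the component of \<open>x\<close>
    orthogonal to \<open>y\<close>; the factor \<open>r\<close> avoids division, and
    \<open>0 \<le> (norm v)\<^sup>2\<close> becomes the inequality.\<close>
  define v where "v = complex_of_real r *\<^sub>C x + (- b) *\<^sub>C y"
  have r: "r > 0"
    using False by (simp add: r_def)
  have yy: "cinner y y = of_real r" and xx: "cinner x x = of_real ((norm x)\<^sup>2)" and yx: "cinner y x = cnj b"
    using cinner_commute[of y x] by (simp_all add: r_def b_def cinner_self_norm)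
  have "complex_of_real ((norm v)\<^sup>2)
      = of_real r * of_real r * of_real ((norm x)\<^sup>2) - of_real r * (b * cnj b)"
    unfolding cinner_self_norm[symmetric] v_def
    by (simp only: cinner_add_left cinner_add_right cinner_scaleC_left cinner_scaleC_right xx yy yx
        b_def[symmetric]) (simp add: algebra_simps)
  also have "\<dots> = of_real (r * (r * (norm x)\<^sup>2 - (cmod b)\<^sup>2))"
    by (simp add: complex_norm_square[symmetric] algebra_simps)
  finally have "(norm v)\<^sup>2 = r * (r * (norm x)\<^sup>2 - (cmod b)\<^sup>2)"
    using of_real_eq_iff by blast
  then have "0 \<le> r * (r * (norm x)\<^sup>2 - (cmod b)\<^sup>2)"
    by (metis zero_le_power2)
  then have "(cmod b)\<^sup>2 \<le> (norm x * norm y)\<^sup>2"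
    using r by (simp add: zero_le_mult_iff r_def power_mult_distrib mult.commute)
  then show ?thesis
    unfolding b_def by (rule power2_le_imp_le) simp
qed

lemma bounded_linear_cinner_right: "bounded_linear (cinner (x::'a::complex_inner))"
proof (rule bounded_linear_intro)
  show "norm (cinner x y) \<le> norm y * norm x" for y
    using cinner_Cauchy_Schwarz[of x y] by (simp add: mult.commute)
qed (simp_all add: cinner_add_right scaleR_scaleC cinner_scaleC_right scaleR_conv_of_real)

section \<open>Linear operators on a domain and their quadratic forms\<close>

locale operator_on =
  fixes D :: "'a::complex_inner set" and T :: "'a \<Rightarrow> 'a"
  assumes linear_operator: "linear_operator D T"
begin

lemma domain_add: "x \<in> D \<Longrightarrow> y \<in> D \<Longrightarrow> x + y \<in> D"
  and domain_scaleC: "x \<in> D \<Longrightarrow> c *\<^sub>C x \<in> D"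
  and op_add: "x \<in> D \<Longrightarrow> y \<in> D \<Longrightarrow> T (x + y) = T x + T y"
  and op_scaleC: "x \<in> D \<Longrightarrow> T (c *\<^sub>C x) = c *\<^sub>C T x"
  using linear_operator unfolding linear_operator_def
  by (auto intro: cvec.subspace_add cvec.subspace_scale)

text \<open>Nothing forces \<open>cinner (T x) y\<close> to be small along a weakly null sequence of
  \<open>x\<close>, so it is bracketed with the quadratic term: \<open>exists_aligned_scalar\<close>
  controls the two jointly.\<close>

lemma form_perturb:
  assumes "x \<in> D" "y \<in> D"
  shows "cinner (T (x + s *\<^sub>C y)) (x + s *\<^sub>C y)
    = cinner (T x) x + s * cinner (T y) x
      + (cnj s * cinner (T x) y + of_real ((cmod s)\<^sup>2) * cinner (T y) y)"
  using assms
  by (simp add: op_add op_scaleC domain_scaleC cinner_add_left cinner_add_right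
      cinner_scaleC_left cinner_scaleC_right complex_norm_square algebra_simps
      del: of_real_power)

lemma form_scaleC:
  "x \<in> D \<Longrightarrow> cinner (T (c *\<^sub>C x)) (c *\<^sub>C x) = of_real ((cmod c)\<^sup>2) * cinner (T x) x"
  by (simp add: op_scaleC cinner_scaleC_left cinner_scaleC_right complex_norm_square del: of_real_power)

text \<open>Both \<open>s\<close> and \<open>s * s\<close> sum to 0 over the fourth roots of unity,
  so the weight \<open>s\<close> leaves only the term carrying \<open>cnj s\<close>.\<close>

lemma polarization:
  assumes "x \<in> D" "y \<in> D"
  shows "4 * cinner (T x) y = (\<Sum>s\<in>{1, -1, \<i>, -\<i>}. s * cinner (T (x + s *\<^sub>C y)) (x + s *\<^sub>C y))"
proof -
  \<comment> \<open>Distinctness lets the sum over the set expand into four terms.\<close>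
  have "\<i> \<noteq> 1" "\<i> \<noteq> -1" "-\<i> \<noteq> 1" "-\<i> \<noteq> -1" "\<i> \<noteq> -\<i>"
    by (auto simp: complex_eq_iff)
  then show ?thesis
    by (simp add: form_perturb[OF assms] algebra_simps)
qed

text \<open>Polarization turns the bound on the diagonal into one on \<open>cinner (T x) y\<close>,
  which is then tested with \<open>y\<close> a multiple of \<open>T x\<close>.\<close>

lemma bounded_if_form_bounded:
  assumes dense: "closure D = UNIV"
    and form: "\<And>x. x \<in> D \<Longrightarrow> cmod (cinner (T x) x) \<le> C * (norm x)\<^sup>2" and "C \<ge> 0"
  shows "bounded_operator D T"
proof -
  have form_D: "cmod (cinner (T x) y) \<le> C * (norm x + norm y)\<^sup>2" if "x \<in> D" "y \<in> D" for x y
  proof -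
    let ?q = "\<lambda>s. cinner (T (x + s *\<^sub>C y)) (x + s *\<^sub>C y)"
    have "cmod (s * ?q s) \<le> C * (norm x + norm y)\<^sup>2" if s: "s \<in> {1, -1, \<i>, -\<i>}" for s
    proof -
      have "cmod s = 1"
        using s by auto
      then have "norm (x + s *\<^sub>C y) \<le> norm x + norm y"
        using norm_triangle_ineq[of x "s *\<^sub>C y"] by (simp add: norm_scaleC)
      then have "C * (norm (x + s *\<^sub>C y))\<^sup>2 \<le> C * (norm x + norm y)\<^sup>2"
        using \<open>C \<ge> 0\<close> by (intro mult_left_mono power_mono) auto
      then show ?thesis
        using form[of "x + s *\<^sub>C y"] \<open>cmod s = 1\<close> \<open>x \<in> D\<close> \<open>y \<in> D\<close>
        by (simp add: norm_mult domain_add domain_scaleC)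
    qed
    then have "cmod (4 * cinner (T x) y)
        \<le> of_nat (card {1, -1, \<i>, -\<i>}) * (C * (norm x + norm y)\<^sup>2)"
      unfolding polarization[OF that]
      by (intro order_trans[OF norm_sum] sum_bounded_above)
    also have "\<dots> \<le> 4 * (C * (norm x + norm y)\<^sup>2)"
      using \<open>C \<ge> 0\<close> card_insert_le_m1 by (intro mult_right_mono) (auto simp: card_insert_if)
    finally show ?thesis
      by (simp add: norm_mult)
  qed
  \<comment> \<open>\<open>T x\<close> may lie outside \<open>D\<close>, so the bound is first
    extended to all \<open>y\<close> by density; continuity is needed in \<open>y\<close>
    only.\<close>
  have form_all: "cmod (cinner (T x) y) \<le> C * (norm x + norm y)\<^sup>2" if "x \<in> D" for x y
  proof -
    have "closed {y. cmod (cinner (T x) y) \<le> C * (norm x + norm y)\<^sup>2}"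
      by (intro closed_Collect_le continuous_intros
          linear_continuous_on bounded_linear_cinner_right)
    then have "closure D \<subseteq> {y. cmod (cinner (T x) y) \<le> C * (norm x + norm y)\<^sup>2}"
      using form_D[OF that] by (intro closure_minimal) auto
    then show ?thesis
      using dense by auto
  qed
  have "norm (T x) \<le> 4 * C * norm x" if "x \<in> D" for x
  proof (cases "T x = 0")
    case True
    then show ?thesis
      using \<open>C \<ge> 0\<close> by simp
  next
    case False
    have "x \<noteq> 0"
      using op_scaleC[OF that, of 0] False by auto
    \<comment> \<open>The test vector gets the norm of \<open>x\<close>, so the bound becomes
      \<open>C * (2 * norm x)\<^sup>2\<close>, the source of the constant
      \<open>4 * C\<close>.\<close>
    define s where "s = norm x / norm (T x)"
    have "cmod (cinner (T x) (of_real s *\<^sub>C T x)) = norm x * norm (T x)"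
      using False
      by (simp add: cinner_scaleC_right cinner_self_norm norm_mult s_def power2_eq_square
          norm_divide)
    moreover have "norm (of_real s *\<^sub>C T x) = norm x"
      using False by (simp add: norm_scaleC s_def norm_divide)
    ultimately have "norm x * norm (T x) \<le> norm x * (4 * C * norm x)"
      using form_all[OF that, of "of_real s *\<^sub>C T x"] by (simp add: power2_eq_square algebra_simps)
    then show ?thesis
      using \<open>x \<noteq> 0\<close> by simp
  qed
  then show ?thesis
    unfolding bounded_operator_def by blast
qed

lemma form_unbounded_on_sphere:
  assumes "closure D = UNIV" "\<not> bounded_operator D T"
  obtains y where "y \<in> D" "norm y = 1" "cmod (cinner (T y) y) > C"
proof -
  \<comment> \<open>\<open>C\<close> is arbitrary, while the boundedness criterion wants a
    nonnegative constant, hence the absolute value.\<close>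
  obtain x where x: "x \<in> D" "cmod (cinner (T x) x) > \<bar>C\<bar> * (norm x)\<^sup>2"
    using bounded_if_form_bounded[OF assms(1), of "\<bar>C\<bar>"] assms(2) by force
  have "x \<noteq> 0"
    using x op_scaleC[of x 0] by auto
  define y where "y = of_real (inverse (norm x)) *\<^sub>C x"
  have "cmod (cinner (T y) y) = cmod (cinner (T x) x) / (norm x)\<^sup>2"
    unfolding y_def form_scaleC[OF x(1)]
    by (simp add: norm_mult norm_inverse norm_power power_inverse divide_inverse mult.commute)
  also have "\<dots> > \<bar>C\<bar>"
    using x \<open>x \<noteq> 0\<close> by (simp add: less_divide_eq)
  finally have "cmod (cinner (T y) y) > C"
    by simp
  moreover have "y \<in> D" "norm y = 1"
    using x \<open>x \<noteq> 0\<close> by (simp_all add: y_def domain_scaleC norm_scaleC norm_inverse)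
  ultimately show thesis
    using that by blast
qed

text \<open>Perturbed vectors are only asymptotically of norm 1. Normalizing them multiplies by
  scalars tending to 1, which changes neither limit.\<close>

lemma essential_numerical_rangeI:
  assumes D: "\<And>n. v n \<in> D" and nz: "\<And>n. v n \<noteq> 0" and norm: "(\<lambda>n. norm (v n)) \<longlonglongrightarrow> 1"
    and weak: "weakly_tendsto v 0" and lim: "(\<lambda>n. cinner (T (v n)) (v n)) \<longlonglongrightarrow> w"
  shows "w \<in> essential_numerical_range D T"
proof -
  define u where "u n = of_real (inverse (norm (v n))) *\<^sub>C v n" for n
  have inv: "(\<lambda>n. complex_of_real (inverse (norm (v n)))) \<longlonglongrightarrow> 1"
    using tendsto_of_real[OF tendsto_inverse[OF norm], where 'a = complex] by simp
  have "(\<lambda>n. cinner (u n) y) \<longlonglongrightarrow> 1 * 0" for y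
    unfolding u_def cinner_scaleC_left
    using weak by (intro tendsto_mult inv) (simp add: weakly_tendsto_def)
  then have "weakly_tendsto u 0"
    by (simp add: weakly_tendsto_def)
  moreover have "(\<lambda>n. cinner (T (u n)) (u n)) \<longlonglongrightarrow> of_real ((cmod 1)\<^sup>2) * w"
    unfolding u_def form_scaleC[OF D] by (intro tendsto_intros inv lim)
  moreover have "u n \<in> D" "norm (u n) = 1" for n
    using D nz by (simp_all add: u_def domain_scaleC norm_scaleC norm_inverse)
  ultimately show ?thesis
    unfolding essential_numerical_range_def by auto
qed

end

lemma exists_aligned_scalar:
  fixes a l :: complex
  assumes "M \<ge> 0" "l \<noteq> 0"
  obtains s where "cmod (cnj s * a + of_real ((cmod s)\<^sup>2) * l) = M" "(cmod s)\<^sup>2 * cmod l \<le> M"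
proof -
  \<comment> \<open>The phase \<open>w\<close> turns the linear term into a nonnegative multiple of
    \<open>sgn l\<close>; no cancellation with the quadratic term is then possible.\<close>
  obtain w where w: "cmod w = 1" "cnj w * a = of_real (cmod a) * sgn l"
  proof (cases "a = 0")
    case True
    then show ?thesis
      using that[of 1] by simp
  next
    case False
    have "cnj (cnj (sgn l) * sgn a) * a = sgn l * (a * cnj a) / of_real (cmod a)"
      by (simp add: sgn_div_norm scaleR_conv_of_real divide_simps)
    also have "\<dots> = of_real (cmod a) * sgn l"
      using False by (simp add: complex_norm_square[symmetric] power2_eq_square)
    finally show ?thesis
      using that[of "cnj (sgn l) * sgn a"] False assms by (simp add: norm_mult norm_sgn)
  qed
  let ?f = "\<lambda>t. t * cmod a + t\<^sup>2 * cmod l"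
  \<comment> \<open>At \<open>t = b\<close> the quadratic term alone equals \<open>M\<close>, so
    \<open>?f\<close> takes the value \<open>M\<close> somewhere on the interval from 0 to
    \<open>b\<close>, whatever the size of \<open>a\<close>.\<close>
  define b where "b = sqrt (M / cmod l)"
  have "b \<ge> 0" "b\<^sup>2 * cmod l = M"
    using assms by (simp_all add: b_def)
  then have "\<exists>t\<ge>0. t \<le> b \<and> ?f t = M"
    using assms by (intro IVT') (auto intro!: continuous_intros)
  then obtain t where t: "t \<ge> 0" "?f t = M"
    by blast
  have "cnj (of_real t * w) * a + of_real ((cmod (of_real t * w))\<^sup>2) * l
      = of_real t * (cnj w * a) + of_real (t\<^sup>2) * l"
    using w t by (simp add: norm_mult)
  also have "\<dots> = of_real (?f t) * sgn l"
    unfolding w(2) using assms(2)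
    by (simp add: sgn_div_norm scaleR_conv_of_real algebra_simps divide_simps)
  finally have "cmod (cnj (of_real t * w) * a + of_real ((cmod (of_real t * w))\<^sup>2) * l) = M"
    using t assms by (simp add: norm_mult norm_sgn)
  moreover have "(cmod (of_real t * w))\<^sup>2 * cmod l \<le> M"
    using t w by (simp add: norm_mult) (smt (verit) norm_ge_zero mult_nonneg_nonneg)
  ultimately show thesis
    using that by blast
qed

section \<open>Perturbing a sequence to reach a prescribed distance from a point of the
  range\<close>

context operator_on
begin

lemma approximate_perturbation:
  assumes "closure D = UNIV" "\<not> bounded_operator D T" "M \<ge> 0" "0 < e" "e < 1"
    and x: "\<And>n. x n \<in> D" "weakly_tendsto x 0" "(\<lambda>n. cinner (T (x n)) (x n)) \<longlonglongrightarrow> z"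
  obtains n p where "n \<ge> k" "p \<in> D" "norm p \<le> e"
    "\<bar>dist (cinner (T (x n + p)) (x n + p)) z - M\<bar> \<le> e"
proof -
  \<comment> \<open>The threshold \<open>M / e\<^sup>2\<close> is what forces
    \<open>cmod s \<le> e\<close> below. As \<open>y\<close> is fixed before \<open>n\<close>, weak
    convergence can be tested against \<open>T y\<close>.\<close>
  obtain y where y: "y \<in> D" "norm y = 1" "cmod (cinner (T y) y) > M / e\<^sup>2"
    using form_unbounded_on_sphere[OF assms(1,2)] .
  let ?l = "cinner (T y) y"
  have "M / e\<^sup>2 \<ge> 0"
    using assms by simp
  then have l: "?l \<noteq> 0"
    using y(3) by auto
  have "(\<lambda>n. cmod (cinner (x n) (T y))) \<longlonglongrightarrow> 0"
    using x(2) by (simp add: weakly_tendsto_def tendsto_norm_zero_iff)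
  moreover have "(\<lambda>n. dist (cinner (T (x n)) (x n)) z) \<longlonglongrightarrow> 0"
    using x(3) by (subst (asm) tendsto_dist_iff)
  ultimately have "(\<lambda>n. cmod (cinner (x n) (T y)) + dist (cinner (T (x n)) (x n)) z) \<longlonglongrightarrow> 0"
    using tendsto_add_zero by blast
  then have "\<forall>\<^sub>F n in sequentially. cmod (cinner (x n) (T y)) + dist (cinner (T (x n)) (x n)) z < e"
    using \<open>0 < e\<close> by (rule order_tendstoD(2))
  then have "\<forall>\<^sub>F n in sequentially. n \<ge> k
      \<and> cmod (cinner (x n) (T y)) + dist (cinner (T (x n)) (x n)) z < e"
    by (intro eventually_conj eventually_ge_at_top)
  then obtain n where n: "n \<ge> k"
    "cmod (cinner (x n) (T y)) + dist (cinner (T (x n)) (x n)) z < e"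
    using eventually_happens' sequentially_bot by blast
  have sym: "cmod (cinner (x n) (T y)) = cmod (cinner (T y) (x n))"
    by (metis cinner_commute complex_mod_cnj)
  obtain s where s: "cmod (cnj s * cinner (T (x n)) y + of_real ((cmod s)\<^sup>2) * ?l) = M"
      "(cmod s)\<^sup>2 * cmod ?l \<le> M"
    using exists_aligned_scalar[OF \<open>M \<ge> 0\<close> l] .
  have "M \<le> e\<^sup>2 * cmod ?l"
    using y(3) \<open>0 < e\<close> by (simp add: divide_simps mult.commute)
  then have "(cmod s)\<^sup>2 * cmod ?l \<le> e\<^sup>2 * cmod ?l"
    using s(2) by linarith
  then have "(cmod s)\<^sup>2 \<le> e\<^sup>2"
    using l by simp
  then have se: "cmod s \<le> e"
    using \<open>0 < e\<close> by (auto intro: power2_le_imp_le)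
  \<comment> \<open>The displacement from \<open>z\<close> splits into \<open>?m\<close>, of modulus
    exactly \<open>M\<close>, and an error \<open>?d\<close> of modulus at most
    \<open>e\<close>.\<close>
  let ?m = "cnj s * cinner (T (x n)) y + of_real ((cmod s)\<^sup>2) * ?l"
  let ?d = "cinner (T (x n)) (x n) - z + s * cinner (T y) (x n)"
  have "cmod ?d \<le> dist (cinner (T (x n)) (x n)) z + cmod s * cmod (cinner (T y) (x n))"
    by (metis dist_norm norm_mult norm_triangle_ineq)
  also have "\<dots> \<le> e"
    using n(2) se \<open>e < 1\<close> mult_left_le_one_le[of "cmod (cinner (T y) (x n))" "cmod s"] by (simp add: sym)
  finally have "cmod ?d \<le> e" .
  moreover have "cinner (T (x n + s *\<^sub>C y)) (x n + s *\<^sub>C y) - z = ?d + ?m"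
    by (simp add: form_perturb[OF x(1) y(1)])
  moreover have "\<bar>cmod (?d + ?m) - cmod ?m\<bar> \<le> cmod ?d"
    using norm_triangle_ineq3[of "?d + ?m" ?m] by simp
  ultimately have "\<bar>dist (cinner (T (x n + s *\<^sub>C y)) (x n + s *\<^sub>C y)) z - M\<bar> \<le> e"
    using s(1) unfolding dist_norm by (simp only:)
  then show thesis
    using that[OF n(1), of "s *\<^sub>C y"] y se by (simp add: domain_scaleC norm_scaleC)
qed

lemma essential_numerical_range_meets_sphere:
  assumes "closure D = UNIV" "\<not> bounded_operator D T" "M \<ge> 0"
    and z: "z \<in> essential_numerical_range D T"
  obtains w where "w \<in> essential_numerical_range D T" "dist w z = M"
proof -
  obtain x where x: "\<And>n. x n \<in> D" "\<And>n. norm (x n) = 1" "weakly_tendsto x 0"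
      "(\<lambda>n. cinner (T (x n)) (x n)) \<longlonglongrightarrow> z"
    using z unfolding essential_numerical_range_def by auto
  \<comment> \<open>The double \<open>Suc\<close> keeps \<open>e k < 1\<close> even at
    \<open>k = 0\<close>; this also makes every \<open>v k\<close> below nonzero.\<close>
  define e where "e k = inverse (real (Suc (Suc k)))" for k
  have e: "0 < e k" "e k < 1" for k
    by (simp_all add: e_def inverse_less_1_iff)
  have e0: "e \<longlonglongrightarrow> 0"
    unfolding e_def using LIMSEQ_Suc[OF LIMSEQ_inverse_real_of_nat] by simp
  have "\<exists>n p. n \<ge> k \<and> p \<in> D \<and> norm p \<le> e k
      \<and> \<bar>dist (cinner (T (x n + p)) (x n + p)) z - M\<bar> \<le> e k" for k
    using approximate_perturbation[OF assms(1-3) e x(1,3,4)] by metis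
  then obtain n p where np: "\<And>k. n k \<ge> k" "\<And>k. p k \<in> D" "\<And>k. norm (p k) \<le> e k"
      "\<And>k. \<bar>dist (cinner (T (x (n k) + p k)) (x (n k) + p k)) z - M\<bar> \<le> e k"
    by metis
  define v where "v k = x (n k) + p k" for k
  define q where "q k = cinner (T (v k)) (v k)" for k
  have vD: "v k \<in> D" for k
    using x np by (simp add: v_def domain_add)
  have near: "\<bar>norm (v k) - 1\<bar> \<le> e k" for k
    using norm_triangle_ineq3[of "v k" "x (n k)"] np(3)[of k] x(2)[of "n k"] by (simp add: v_def)
  have nz: "v k \<noteq> 0" for k
    using near[of k] e(2)[of k] by auto
  have "(\<lambda>k. norm (v k) - 1) \<longlonglongrightarrow> 0"
    using near by (intro Lim_null_comparison[OF _ e0] always_eventually) simp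
  then have norm1: "(\<lambda>k. norm (v k)) \<longlonglongrightarrow> 1"
    by (simp add: LIM_zero_iff)
  \<comment> \<open>\<open>n\<close> need not be monotone; \<open>n k \<ge> k\<close> suffices to
    pass to the limit along it.\<close>
  have n_top: "filterlim n at_top sequentially"
    using np(1) by (intro filterlim_at_top_mono[OF filterlim_ident]) simp
  have weak: "(\<lambda>k. cinner (v k) y) \<longlonglongrightarrow> 0" for y
  proof -
    have "(\<lambda>k. cinner (x (n k)) y) \<longlonglongrightarrow> 0"
      using x(3) by (intro filterlim_compose[OF _ n_top]) (simp add: weakly_tendsto_def)
    moreover have "(\<lambda>k. cinner (p k) y) \<longlonglongrightarrow> 0"
    proof (rule Lim_null_comparison)
      show "\<forall>\<^sub>F k in sequentially. norm (cinner (p k) y) \<le> e k * norm y"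
        using np(3)
        by (intro always_eventually allI order.trans[OF cinner_Cauchy_Schwarz] mult_right_mono) auto
      show "(\<lambda>k. e k * norm y) \<longlonglongrightarrow> 0"
        using tendsto_mult_right[OF e0, of "norm y"] by simp
    qed
    ultimately show ?thesis
      unfolding v_def cinner_add_left using tendsto_add by fastforce
  qed
  have "(\<lambda>k. dist (q k) z - M) \<longlonglongrightarrow> 0"
    using np(4) by (intro Lim_null_comparison[OF _ e0] always_eventually) (simp add: q_def v_def)
  then have dq: "(\<lambda>k. dist (q k) z) \<longlonglongrightarrow> M"
    by (simp add: LIM_zero_iff)
  \<comment> \<open>The values \<open>q k\<close> stay in a disc, so compactness yields a limit
    point \<open>w\<close>, and \<open>dq\<close> fixes its distance from \<open>z\<close>.\<close>
  have "dist (q k) z \<le> M + 1" for k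
    using np(4)[of k] e(2)[of k] by (simp add: q_def v_def)
  then have "range q \<subseteq> cball z (M + 1)"
    by (auto simp: dist_commute)
  then have "bounded (range q)"
    using bounded_cball bounded_subset by blast
  then obtain w r where r: "strict_mono r" "(q \<circ> r) \<longlonglongrightarrow> w"
    using bounded_imp_convergent_subsequence by blast
  have "w \<in> essential_numerical_range D T"
  proof (rule essential_numerical_rangeI[of "v \<circ> r"])
    show "(\<lambda>k. norm ((v \<circ> r) k)) \<longlonglongrightarrow> 1"
      using LIMSEQ_subseq_LIMSEQ[OF norm1 r(1)] by (simp add: o_def)
    show "weakly_tendsto (v \<circ> r) 0"
      using LIMSEQ_subseq_LIMSEQ[OF weak r(1)] by (simp add: weakly_tendsto_def o_def)
    show "(\<lambda>k. cinner (T ((v \<circ> r) k)) ((v \<circ> r) k)) \<longlonglongrightarrow> w"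
      using r(2) by (simp add: q_def o_def)
  qed (simp_all add: vD nz)
  moreover have "dist w z = M"
  proof (rule LIMSEQ_unique)
    show "(\<lambda>k. dist ((q \<circ> r) k) z) \<longlonglongrightarrow> dist w z"
      by (intro tendsto_intros r(2))
    show "(\<lambda>k. dist ((q \<circ> r) k) z) \<longlonglongrightarrow> M"
      using LIMSEQ_subseq_LIMSEQ[OF dq r(1)] by (simp add: o_def)
  qed
  ultimately show thesis
    using that by blast
qed

end

theorem corollary2p4:
  fixes D :: "'a::complex_hilbert set" and T :: "'a \<Rightarrow> 'a"
  assumes "linear_operator D T"
    and "densely_defined D"
    and "\<not> bounded_operator D T"
  shows "essential_numerical_range D T = {} \<or> \<not> bounded (essential_numerical_range D T)"
proof (rule disjCI)
  assume "\<not> \<not> bounded (essential_numerical_range D T)"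
  then have bounded: "bounded (essential_numerical_range D T)"
    by simp
  interpret operator_on D T
    by unfold_locales (rule assms(1))
  show "essential_numerical_range D T = {}"
  proof (rule equals0I)
    fix z assume z: "z \<in> essential_numerical_range D T"
    \<comment> \<open>The bound is centred at \<open>z\<close> itself, so a point at distance
      \<open>B + 1\<close> from \<open>z\<close> contradicts it.\<close>
    obtain B where B: "\<And>w. w \<in> essential_numerical_range D T \<Longrightarrow> dist z w \<le> B"
      using bounded bounded_any_center by metis
    have "B \<ge> 0"
      using B[OF z] by simp
    then obtain w where "w \<in> essential_numerical_range D T" "dist w z = B + 1"
      using essential_numerical_range_meets_sphere[OF _ assms(3) _ z, of "B + 1"] assms(2)
      by (auto simp: densely_defined_def)
    then show False
      using B[of w] by (simp add: dist_commute)
  qed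
qed

end
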